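(* Let $G=(V,E)$ be a fixed network with $m=|E|$ edges and integral capacity vector $c$. Let $\mathcal D$ be an unknown distribution over capacity vectors $c^i$ with $c^i_e\in[0,c_e]\cap\mathbb{Z}$ for all $e$, and let $\mathcal F$ be the set of integral vectors $f$ with $0\le f_e\le c_e$ for all $e$ (flow conservation not required). Let $c^1,\dots,c^s$ be sampled i.i.d. from $\mathcal D$, let $\widehat f=\mathrm{argmin}_{f\in\mathcal F}\frac1s\sum_{j=1}^s\|f-f^*(c^j)\|_1$ and $\widetilde f=\mathrm{argmin}_{f\in\mathcal F}\mathbb{E}_{c^i\sim\mathcal D}\|f-f^*(c^i)\|_1$. If $s=\Omega\big((\max_e c_e^2\cdot m^2)(\log m+\log(1/p))\big)$, then with probability at least $1-p$, \[\mathbb{E}_{c^i\sim\mathcal D}\|\widehat f-f^*(c^i)\|_1\le\mathbb{E}_{c^i\sim\mathcal D}\|\widetilde f-f^*(c^i)\|_1+O(1).\]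
   Context: Standing assumption (Assumption 1 of the paper): for each capacity vector $c^i$ on the fixed graph there is a uniquely associated, computable maximum flow, denoted $f^*(c^i)$. *)

theory Defs
  imports "HOL-Probability.Probability" "Graph_Theory.Digraph"
begin

text \<open>
  Vectors indexed by the edges of a network are functions on the arcs of \<open>G\<close>.  The integral ones
  are taken in the extensional function space \<open>\<Pi>\<^sub>E\<close>, so that a vector carries no information
  outside \<open>arcs G\<close> and a box of such vectors is a finite set.
\<close>

definition integral_box :: "('v, 'e) pre_digraph \<Rightarrow> ('e \<Rightarrow> nat) \<Rightarrow> ('e \<Rightarrow> nat) set" where
  "integral_box G c = (\<Pi>\<^sub>E e\<in>arcs G. {0..c e})"

definition is_flow ::
  "('v, 'e) pre_digraph \<Rightarrow> 'v \<Rightarrow> 'v \<Rightarrow> ('e \<Rightarrow> nat) \<Rightarrow> ('e \<Rightarrow> real) \<Rightarrow> bool" where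
  "is_flow G src snk c f \<longleftrightarrow>
     (\<forall>e\<in>arcs G. 0 \<le> f e \<and> f e \<le> real (c e)) \<and>
     (\<forall>v\<in>verts G - {src, snk}. (\<Sum>e\<in>in_arcs G v. f e) = (\<Sum>e\<in>out_arcs G v. f e))"

definition flow_value :: "('v, 'e) pre_digraph \<Rightarrow> 'v \<Rightarrow> ('e \<Rightarrow> real) \<Rightarrow> real" where
  "flow_value G src f = (\<Sum>e\<in>out_arcs G src. f e) - (\<Sum>e\<in>in_arcs G src. f e)"

definition is_max_flow ::
  "('v, 'e) pre_digraph \<Rightarrow> 'v \<Rightarrow> 'v \<Rightarrow> ('e \<Rightarrow> nat) \<Rightarrow> ('e \<Rightarrow> real) \<Rightarrow> bool" where
  "is_max_flow G src snk c f \<longleftrightarrow> is_arg_max (flow_value G src) (is_flow G src snk c) f"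

definition l1_dist :: "('v, 'e) pre_digraph \<Rightarrow> ('e \<Rightarrow> nat) \<Rightarrow> ('e \<Rightarrow> real) \<Rightarrow> real" where
  "l1_dist G f g = (\<Sum>e\<in>arcs G. \<bar>real (f e) - g e\<bar>)"

definition expected_loss ::
  "('v, 'e) pre_digraph \<Rightarrow> (('e \<Rightarrow> nat) \<Rightarrow> 'e \<Rightarrow> real) \<Rightarrow> ('e \<Rightarrow> nat) pmf \<Rightarrow> ('e \<Rightarrow> nat) \<Rightarrow> real" where
  "expected_loss G fstar D f = measure_pmf.expectation D (\<lambda>c'. l1_dist G f (fstar c'))"

definition empirical_loss ::
  "('v, 'e) pre_digraph \<Rightarrow> (('e \<Rightarrow> nat) \<Rightarrow> 'e \<Rightarrow> real) \<Rightarrow> nat \<Rightarrow> (nat \<Rightarrow> 'e \<Rightarrow> nat) \<Rightarrow> ('e \<Rightarrow> nat) \<Rightarrow> real" where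
  "empirical_loss G fstar s cs f = 1 / real s * (\<Sum>j=1..s. l1_dist G f (fstar (cs j)))"

text \<open>
  The law of \<open>s\<close> independent draws from \<open>D\<close>, indexed by \<open>{1..s}\<close>.  The second argument of
  \<open>Pi_pmf\<close> is only the value at indices outside that set.
\<close>

definition iid_samples :: "nat \<Rightarrow> 'a pmf \<Rightarrow> (nat \<Rightarrow> 'a) pmf" where
  "iid_samples s D = Pi_pmf {1..s} undefined (\<lambda>_. D)"

end

theory Submission
  imports Defs
begin

text \<open>
  Both losses are sums over the edges of one-dimensional mean absolute deviations, so on the box the
  minimizations decouple into median problems, one per edge.  If the empirical minimizer on an edge
  is worse than \<open>ftilde\<close> by more than \<open>2 / m\<close>, then by convexity the empirical loss already fails to
  separate \<open>ftilde\<close> from one of two fixed points, namely the first bad value on either side.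
  Hoeffding's inequality for these two points avoids a union bound over all values, which would cost
  a factor \<open>ln c\<close>.

  The factor two in the union bound is not affordable when \<open>m = 1\<close> and \<open>p\<close> is close to \<open>1\<close>: the
  hypothesis then allows samples that are much smaller than \<open>c\<^sup>2\<close>, and a success probability of
  order \<open>s / c\<^sup>2\<close> has to be shown.  The empirical medians lie between the two bad values as soon as
  fewer than half of the samples fall beyond either of them, where each side has probability at most
  \<open>1 / 2 - \<delta>\<close> with \<open>\<delta>\<close> of order \<open>1 / c\<close>.  The probability of this event is bounded below by an exact
  computation with binomial tails.
\<close>

subsection \<open>Binomial tails\<close>

text \<open>The squared form goes by induction. The ratio of consecutive central binomial
  coefficients is \<open>2 * (2 * k + 1) / (k + 1)\<close>, and the step comes down to
  \<open>4 * k * (k + 1) \<le> (2 * k + 1)\<^sup>2\<close>.\<close>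

lemma central_binomial_sqrt_lower_bound:
  assumes "k > 0"
  shows "4 ^ k / (2 * sqrt (real k)) \<le> real (2 * k choose k)"
proof -
  have sq: "16 ^ k \<le> 4 * real k * (real (2 * k choose k))\<^sup>2" if "k > 0" for k
    using that
  proof (induction k rule: nat_induct_non_zero)
    case 1
    then show ?case by simp
  next
    case (Suc k)
    have "Suc k * (Suc (Suc (2 * k)) choose Suc k) = Suc (Suc (2 * k)) * (Suc (2 * k) choose k)"
      by (simp only: Suc_times_binomial_eq mult.commute)
    also have "\<dots> = 2 * (Suc k * (Suc (2 * k) choose k))"
      by simp
    also have "Suc k * (Suc (2 * k) choose k) = Suc (2 * k) * (2 * k choose k)"
      using binomial_absorb_comp[of "Suc (2 * k)" k] by (simp add: Suc_diff_le)
    finally have "real (Suc k * (Suc (Suc (2 * k)) choose Suc k)) = real (2 * (Suc (2 * k) * (2 * k choose k)))"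
      by (rule arg_cong)
    then have eq: "real (2 * Suc k choose Suc k) = 2 * (2 * real k + 1) * real (2 * k choose k) / (real k + 1)"
      by (simp add: field_simps del: binomial_Suc_Suc)
    have "16 ^ Suc k \<le> 16 * (4 * real k * (real (2 * k choose k))\<^sup>2)"
      using Suc.IH by simp
    also have "\<dots> \<le> 4 * (2 * (2 * real k + 1))\<^sup>2 / (real k + 1) * (real (2 * k choose k))\<^sup>2"
    proof -
      have "64 * real k \<le> 4 * (2 * (2 * real k + 1))\<^sup>2 / (real k + 1)"
        by (simp add: field_simps power2_eq_square)
      from mult_right_mono[OF this, of "(real (2 * k choose k))\<^sup>2"] show ?thesis by simp
    qed
    also have "\<dots> = 4 * real (Suc k) * (real (2 * Suc k choose Suc k))\<^sup>2"
      unfolding eq by (simp add: power_divide power_mult_distrib divide_simps) (simp add: power2_eq_square)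
    finally show ?case .
  qed
  have "(4 ^ k / (2 * sqrt (real k)))\<^sup>2 = 16 ^ k / (4 * real k)"
  proof -
    have "((4::real) ^ k)\<^sup>2 = 16 ^ k"
      by (simp add: power2_eq_square flip: power_mult_distrib)
    then show ?thesis by (simp add: power_divide power_mult_distrib)
  qed
  also have "\<dots> \<le> (real (2 * k choose k))\<^sup>2"
    using sq[OF assms] assms by (simp add: field_simps)
  finally show ?thesis
    by (rule power2_le_imp_le) simp
qed

text \<open>The probability that a binomial variable with parameters \<open>n\<close> and
  \<open>x\<close> is strictly below \<open>k\<close>. It is written as a polynomial in a real
  \<open>x\<close> so that it can be differentiated.\<close>

definition binomial_lower_tail :: "nat \<Rightarrow> nat \<Rightarrow> real \<Rightarrow> real" where
  "binomial_lower_tail n k x = (\<Sum>i<k. real (n choose i) * x ^ i * (1 - x) ^ (n - i))"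

text \<open>Differentiating term by term gives a telescoping sum: by the absorption identities for
  binomial coefficients, adjacent terms cancel and a single boundary term is left.\<close>

lemma has_real_derivative_binomial_lower_tail:
  assumes "k \<le> n"
  shows "(binomial_lower_tail n k has_real_derivative
    - (real k * real (n choose k) * x ^ (k - 1) * (1 - x) ^ (n - k))) (at x)"
  using assms
proof (induction k)
  case 0
  then show ?case by (simp add: binomial_lower_tail_def[abs_def])
next
  case (Suc k)
  have step: "binomial_lower_tail n (Suc k) =
      (\<lambda>x. binomial_lower_tail n k x + real (n choose k) * x ^ k * (1 - x) ^ (n - k))"
    by (simp add: binomial_lower_tail_def fun_eq_iff)
  have "Suc k * (n choose Suc k) = (n - k) * (n choose k)"
    using Suc.prems binomial_absorb_comp binomial_absorption
    by (metis (no_types, lifting) Suc_le_D binomial_absorption diff_Suc_1)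
  then have "real (Suc k * (n choose Suc k)) = real ((n - k) * (n choose k))"
    by simp
  then have eq: "(1 + real k) * real (n choose Suc k) = real (n - k) * real (n choose k)"
    by (simp only: of_nat_mult of_nat_Suc)
  let ?c = "real (n choose k)"
  have "((\<lambda>x. ?c * x ^ k * (1 - x) ^ (n - k)) has_real_derivative
      ?c * (real k * x ^ (k - 1)) * (1 - x) ^ (n - k) -
      (real (n - k) * ?c) * x ^ k * (1 - x) ^ (n - Suc k)) (at x)"
    by (auto intro!: derivative_eq_intros)
  note DERIV_add[OF Suc.IH this]
  then show ?case
    unfolding step eq[symmetric] using Suc.prems by (simp add: mult_ac)
qed

text \<open>At \<open>1 / 2\<close> the outcomes \<open>i\<close> and \<open>2 * k - i\<close> are
  equally likely, so the lower and the upper tail agree and the middle outcome takes the remaining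
  mass.\<close>

lemma binomial_lower_tail_half:
  assumes "k > 0"
  shows "2 * binomial_lower_tail (2 * k) k (1 / 2) + real (2 * k choose k) / 4 ^ k = 1"
proof -
  let ?C = "\<lambda>i. real (2 * k choose i)"
  have "(\<Sum>i\<in>{k<..2 * k}. ?C i) = (\<Sum>i<k. ?C i)"
    by (rule sum.reindex_bij_witness[of _ "\<lambda>i. 2 * k - i" "\<lambda>i. 2 * k - i"])
       (auto simp: binomial_symmetric[symmetric])
  moreover have "{..2 * k} = {..<k} \<union> {k} \<union> {k<..2 * k}"
    by auto
  then have "(\<Sum>i\<le>2 * k. ?C i) = (\<Sum>i<k. ?C i) + ?C k + (\<Sum>i\<in>{k<..2 * k}. ?C i)"
    by (simp only:) (subst sum.union_disjoint; auto)+
  moreover have "(\<Sum>i\<le>2 * k. ?C i) = 4 ^ k"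
    using choose_row_sum[of "2 * k"] by (simp add: power_mult flip: of_nat_sum)
  moreover have "binomial_lower_tail (2 * k) k (1 / 2) = (\<Sum>i<k. ?C i) / 4 ^ k"
    unfolding binomial_lower_tail_def sum_divide_distrib
  proof (rule sum.cong)
    fix i assume "i \<in> {..<k}"
    then have "(1 / 2 :: real) ^ i * (1 - 1 / 2) ^ (2 * k - i) = (1 / 2) ^ (2 * k)"
      by (simp flip: power_add)
    then show "?C i * (1 / 2) ^ i * (1 - 1 / 2) ^ (2 * k - i) = ?C i / 4 ^ k"
      by (simp add: mult.assoc power_mult power_divide)
  qed simp
  ultimately show ?thesis by (simp add: field_simps)
qed

text \<open>
  The probability that among \<open>2 * k\<close> independent trials with three outcomes both the outcome of
  probability \<open>a\<close> and the outcome of probability \<open>b\<close> occur fewer than \<open>k\<close> times: inclusion-exclusion,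
  where both occur at least \<open>k\<close> times only in a tie.
\<close>

definition both_minorities_poly :: "nat \<Rightarrow> real \<Rightarrow> real \<Rightarrow> real" where
  "both_minorities_poly k a b = binomial_lower_tail (2 * k) k a + binomial_lower_tail (2 * k) k b - 1
     + real (2 * k choose k) * (a * b) ^ k"

lemma both_minorities_poly_commute: "both_minorities_poly k a b = both_minorities_poly k b a"
  by (simp add: both_minorities_poly_def mult.commute)

text \<open>The derivative in the first argument is
  \<open>k * (2 * k choose k) * a ^ (k - 1) * (b ^ k - (1 - a) ^ k)\<close>, which is nonpositive as
  long as \<open>b \<le> 1 - a\<close>.\<close>

lemma both_minorities_poly_antimono:
  assumes "k > 0" "0 \<le> a" "a \<le> a'" "0 \<le> b" "a' + b \<le> 1"
  shows "both_minorities_poly k a' b \<le> both_minorities_poly k a b"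
proof (rule DERIV_nonpos_imp_nonincreasing[OF \<open>a \<le> a'\<close>])
  fix x assume x: "a \<le> x" "x \<le> a'"
  let ?C = "real (2 * k choose k)"
  have "((\<lambda>x. both_minorities_poly k x b) has_real_derivative
      - (real k * ?C * x ^ (k - 1) * (1 - x) ^ (2 * k - k)) + ?C * (real k * (x ^ (k - 1) * b ^ k))) (at x)"
    unfolding both_minorities_poly_def power_mult_distrib
    by (rule has_real_derivative_binomial_lower_tail derivative_eq_intros refl | simp)+
  moreover have "?C * (real k * (x ^ (k - 1) * b ^ k)) \<le> real k * ?C * x ^ (k - 1) * (1 - x) ^ (2 * k - k)"
  proof -
    have "b ^ k \<le> (1 - x) ^ k"
      using assms x by (intro power_mono) auto
    then have "(real k * ?C * x ^ (k - 1)) * b ^ k \<le> (real k * ?C * x ^ (k - 1)) * (1 - x) ^ k"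
      using assms x by (intro mult_left_mono) auto
    then show ?thesis by (simp add: algebra_simps)
  qed
  ultimately show "\<exists>y. ((\<lambda>x. both_minorities_poly k x b) has_real_derivative y) (at x) \<and> y \<le> 0"
    by force
qed

text \<open>The right-hand side is the derivative in \<open>d\<close> of
  \<open>both_minorities_poly k (1 / 2 - d) (1 / 2 - d)\<close>, and the left-hand side is that of
  \<open>k * d\<^sup>2 / 2\<close>.\<close>

lemma both_minorities_poly_half_minus_derivative_bound:
  assumes k: "k > 0" and d: "0 \<le> d" and small: "4 * real k * d\<^sup>2 \<le> 1 / 2"
  shows "real k * d \<le> 2 * real k * real (2 * k choose k) * (1 / 2 - d) ^ (k - 1) *
           ((1 / 2 + d) ^ k - (1 / 2 - d) ^ k)"
proof -
  \<comment> \<open>Writing \<open>1 / 2 - d\<close> and \<open>1 / 2 + d\<close> as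
    \<open>(1 - x) / 2\<close> and \<open>(1 + x) / 2\<close> brings the powers into the range of
    Bernoulli's inequality.\<close>
  define x where "x = 2 * d"
  define K where "K = real k"
  have K: "1 \<le> K" using k by (simp add: K_def)
  have Kx: "K * x\<^sup>2 \<le> 1 / 2" using small by (simp add: x_def K_def power_mult_distrib)
  have x0: "0 \<le> x" using d by (simp add: x_def)
  have "x\<^sup>2 \<le> 1"
    using mult_right_mono[OF K, of "x\<^sup>2"] Kx by simp
  then have x1: "x \<le> 1" using x0 by (simp add: power_le_one_iff abs_square_le_1)
  have bern: "1 + K * x \<le> (1 + x) ^ k"
    using Bernoulli_inequality[of x k] x0 by (simp add: K_def)
  have "(1 - x) ^ k * (1 + K * x) \<le> (1 - x) ^ k * (1 + x) ^ k"
    using bern x1 by (intro mult_left_mono) auto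
  also have "\<dots> \<le> 1"
    unfolding power_mult_distrib[symmetric]
    using x0 x1 by (intro power_le_one) (auto simp: algebra_simps mult_le_one)
  finally have "(1 - x) ^ k \<le> 1 / (1 + K * x)"
    using K x0 by (subst pos_le_divide_eq) (auto simp: add_pos_nonneg)
  moreover have "K * x / (1 + K * x) = 1 - 1 / (1 + K * x)"
    using K x0 by (simp add: divide_simps add_nonneg_eq_0_iff)
  ultimately have gap: "K * x / (1 + K * x) \<le> 1 - (1 - x) ^ k"
    by simp
  \<comment> \<open>This is what the bound \<open>1 / 2\<close> in \<open>small\<close> is for: it
    keeps \<open>(1 - x\<^sup>2) ^ (k - 1)\<close> away from zero.\<close>
  have "1 / 2 \<le> 1 + real (k - 1) * (- x\<^sup>2)"
  proof -
    have "real (k - 1) * x\<^sup>2 \<le> K * x\<^sup>2" by (intro mult_right_mono) (auto simp: K_def)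
    then show ?thesis using Kx by simp
  qed
  also have "\<dots> \<le> (1 + (- x\<^sup>2)) ^ (k - 1)"
    using \<open>x\<^sup>2 \<le> 1\<close> by (intro Bernoulli_inequality) simp
  finally have half: "1 / 2 \<le> (1 - x\<^sup>2) ^ (k - 1)" by simp
  have "(1 - x) ^ k \<le> (1 - x) ^ k * (1 + x) ^ k"
    using mult_left_mono[of 1 "(1 + x) ^ k" "(1 - x) ^ k"] x0 x1 by (simp add: one_le_power)
  then have "(1 + x) ^ k * (1 - (1 - x) ^ k) \<le> (1 + x) ^ k - (1 - x) ^ k"
    by (simp add: algebra_simps)
  moreover have "(1 + x) ^ (k - 1) * (1 - (1 - x) ^ k) \<le> (1 + x) ^ k * (1 - (1 - x) ^ k)"
    using x0 x1 by (intro mult_right_mono power_increasing) (auto simp: power_le_one)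
  ultimately have "(1 - x) ^ (k - 1) * ((1 + x) ^ (k - 1) * (1 - (1 - x) ^ k)) \<le>
      (1 - x) ^ (k - 1) * ((1 + x) ^ k - (1 - x) ^ k)"
    using x1 by (intro mult_left_mono) auto
  moreover have "(1 - x) ^ (k - 1) * ((1 + x) ^ (k - 1) * (1 - (1 - x) ^ k)) =
      (1 - x\<^sup>2) ^ (k - 1) * (1 - (1 - x) ^ k)"
  proof -
    have "(1 - x\<^sup>2) ^ (k - 1) = (1 - x) ^ (k - 1) * (1 + x) ^ (k - 1)"
      unfolding power_mult_distrib[symmetric] by (simp add: algebra_simps power2_eq_square)
    then show ?thesis by simp
  qed
  moreover have "1 / 2 * (K * x / (1 + K * x)) \<le> (1 - x\<^sup>2) ^ (k - 1) * (1 - (1 - x) ^ k)"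
    using K x0 \<open>x\<^sup>2 \<le> 1\<close> by (intro mult_mono half gap) auto
  ultimately have B: "1 / 2 * (K * x / (1 + K * x)) \<le> (1 - x) ^ (k - 1) * ((1 + x) ^ k - (1 - x) ^ k)"
    by linarith
  \<comment> \<open>The factor \<open>1 / (2 * sqrt K)\<close> stands for the central binomial
    bound. It is compensated by the gap, since \<open>sqrt K * x \<le> 1\<close> gives
    \<open>1 + K * x \<le> 2 * sqrt K\<close>.\<close>
  have "x / 8 \<le> 1 / (2 * sqrt K) * (1 / 2 * (K * x / (1 + K * x)))"
  proof -
    have s1: "1 \<le> sqrt K" using K by simp
    have "(sqrt K * x)\<^sup>2 \<le> 1\<^sup>2" using Kx K by (simp add: power_mult_distrib)
    then have "sqrt K * x \<le> 1" by (rule power2_le_imp_le) simp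
    then have "sqrt K * (sqrt K * x) \<le> sqrt K * 1" using s1 by (intro mult_left_mono) auto
    then have "1 + K * x \<le> 2 * sqrt K" using s1 K by (simp only: mult.assoc[symmetric] real_sqrt_mult_self)
    then have "sqrt K * (1 + K * x) \<le> sqrt K * (2 * sqrt K)" using s1 by (intro mult_left_mono) auto
    moreover have "sqrt K * (2 * sqrt K) = 2 * K" using K by simp
    ultimately have "sqrt K * (1 + K * x) \<le> 2 * K" by linarith
    then have "x * (sqrt K * (1 + K * x)) \<le> x * (2 * K)" using x0 by (intro mult_left_mono)
    moreover have "0 < sqrt K * (1 + K * x)" using K x0 by (simp add: add_pos_nonneg)
    ultimately show ?thesis using K x0 by (simp add: field_simps)
  qed
  also have "\<dots> \<le> real (2 * k choose k) / 4 ^ k * ((1 - x) ^ (k - 1) * ((1 + x) ^ k - (1 - x) ^ k))"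
    using central_binomial_sqrt_lower_bound[OF k] K x0
    by (intro mult_mono B) (auto simp: K_def field_simps)
  finally have main: "x / 8 \<le> real (2 * k choose k) / 4 ^ k * ((1 - x) ^ (k - 1) * ((1 + x) ^ k - (1 - x) ^ k))" .
  have half': "1 / 2 - d = (1 - x) / 2" "1 / 2 + d = (1 + x) / 2" by (auto simp: x_def field_simps)
  have four: "(4::real) ^ k = 2 * 2 ^ (k - 1) * 2 ^ k"
    using k by (cases k) (auto simp flip: power_mult_distrib)
  have "real k * d = 4 * K * (x / 8)" by (simp add: K_def x_def)
  also have "\<dots> \<le> 4 * K * (real (2 * k choose k) / 4 ^ k * ((1 - x) ^ (k - 1) * ((1 + x) ^ k - (1 - x) ^ k)))"
    using K by (intro mult_left_mono main) auto
  also have "\<dots> = 2 * real k * real (2 * k choose k) * (1 / 2 - d) ^ (k - 1) *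
           ((1 / 2 + d) ^ k - (1 / 2 - d) ^ k)"
    unfolding half' four K_def by (simp add: power_divide field_simps)
  finally show ?thesis .
qed

text \<open>The difference of the two sides vanishes at \<open>d = 0\<close>, by the formula for
  fair trials, and is nondecreasing by the derivative bound. The smallness condition passes from
  \<open>d\<close> to every point of \<open>[0, d]\<close>.\<close>

lemma both_minorities_poly_lower_bound:
  assumes k: "k > 0" and d: "0 \<le> d" and small: "4 * real k * d\<^sup>2 \<le> 1 / 2"
  shows "real k * d\<^sup>2 / 2 \<le> both_minorities_poly k (1 / 2 - d) (1 / 2 - d)"
proof -
  let ?C = "real (2 * k choose k)"
  let ?G = "\<lambda>x. both_minorities_poly k (1 / 2 - x) (1 / 2 - x) - real k * x\<^sup>2 / 2"
  have "?G 0 \<le> ?G d"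
  proof (rule DERIV_nonneg_imp_nondecreasing[OF d])
    fix x assume x: "0 \<le> x" "x \<le> d"
    have tail: "((\<lambda>x. binomial_lower_tail (2 * k) k (1 / 2 - x)) has_real_derivative
        real k * ?C * (1 / 2 - x) ^ (k - 1) * (1 / 2 + x) ^ k) (at x)"
      by (rule DERIV_cong[OF DERIV_chain2[where g = "\<lambda>x. 1 / 2 - x" and Db = "-1",
            OF has_real_derivative_binomial_lower_tail]])
         (auto intro!: derivative_eq_intros)
    have "(?G has_real_derivative 2 * (real k * ?C * (1 / 2 - x) ^ (k - 1) * (1 / 2 + x) ^ k)
        - 2 * ?C * real k * ((1 / 2 - x) ^ k * (1 / 2 - x) ^ (k - 1)) - real k * x) (at x)"
      unfolding both_minorities_poly_def power_mult_distrib
      by (rule tail derivative_eq_intros refl | simp add: algebra_simps)+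
    moreover have "4 * real k * x\<^sup>2 \<le> 1 / 2"
      using mult_left_mono[OF power_mono[OF x(2,1), of 2], of "4 * real k"] small by simp
    note both_minorities_poly_half_minus_derivative_bound[OF k x(1) this]
    ultimately show "\<exists>y. (?G has_real_derivative y) (at x) \<and> 0 \<le> y"
      by (force simp: algebra_simps)
  qed
  moreover have "?G 0 = 0"
    using binomial_lower_tail_half[OF k] by (simp add: both_minorities_poly_def power_divide flip: power_mult_distrib)
  ultimately show ?thesis by simp
qed

subsection \<open>Independent samples\<close>

lemma bernoulli_pmf_prob_conv_map_pmf:
  "bernoulli_pmf (measure_pmf.prob D A) = map_pmf (\<lambda>x. x \<in> A) D"
proof (rule pmf_eqI)
  fix b
  have "- A = UNIV - A" by auto
  then have "measure_pmf.prob D (- A) = 1 - measure_pmf.prob D A"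
    using measure_pmf.prob_compl[of A D] by simp
  moreover have "(\<lambda>x. x \<in> A) -` {b} = (if b then A else - A)"
    by auto
  ultimately show "pmf (bernoulli_pmf (measure_pmf.prob D A)) b = pmf (map_pmf (\<lambda>x. x \<in> A) D) b"
    by (cases b) (simp_all add: pmf_map)
qed

text \<open>Membership in \<open>A\<close> turns the product of copies of \<open>D\<close> into a
  product of Bernoulli variables, whose number of successes is binomial.\<close>

lemma prob_card_less_iid:
  assumes "finite I"
  shows "measure_pmf.prob (Pi_pmf I d (\<lambda>_. D)) {\<omega>. card {i\<in>I. \<omega> i \<in> A} < k} =
    binomial_lower_tail (card I) k (measure_pmf.prob D A)"
proof -
  let ?p = "measure_pmf.prob D A"
  have "binomial_pmf (card I) ?p =
      map_pmf (\<lambda>\<omega>. card {i\<in>I. \<omega> i}) (Pi_pmf I (d \<in> A) (\<lambda>_. bernoulli_pmf ?p))"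
    using assms by (intro binomial_pmf_altdef') auto
  also have "Pi_pmf I (d \<in> A) (\<lambda>_. bernoulli_pmf ?p) = map_pmf (\<lambda>\<omega>. (\<lambda>x. x \<in> A) \<circ> \<omega>) (Pi_pmf I d (\<lambda>_. D))"
    unfolding bernoulli_pmf_prob_conv_map_pmf using assms by (intro Pi_pmf_map) auto
  finally have "binomial_pmf (card I) ?p = map_pmf (\<lambda>\<omega>. card {i\<in>I. \<omega> i \<in> A}) (Pi_pmf I d (\<lambda>_. D))"
    by (simp add: pmf.map_comp o_def)
  then have "measure_pmf.prob (Pi_pmf I d (\<lambda>_. D)) {\<omega>. card {i\<in>I. \<omega> i \<in> A} < k} =
      measure_pmf.prob (binomial_pmf (card I) ?p) {..<k}"
    by (simp add: vimage_def)
  also have "\<dots> = binomial_lower_tail (card I) k ?p"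
    by (simp add: measure_measure_pmf_finite binomial_lower_tail_def)
  finally show ?thesis .
qed

text \<open>For each \<open>T\<close> of size \<open>k\<close>, consider the event that the draws in
  \<open>T\<close> fall into \<open>A\<close> and the others into \<open>B\<close>. It has
  probability \<open>(a * b) ^ k\<close>, and these events are disjoint because the positions of the
  hits of \<open>A\<close> recover \<open>T\<close>.\<close>

lemma prob_tie_iid_ge:
  assumes I: "finite I" "card I = 2 * k" and disj: "A \<inter> B = {}"
  shows "real (2 * k choose k) * (measure_pmf.prob D A * measure_pmf.prob D B) ^ k \<le>
    measure_pmf.prob (Pi_pmf I d (\<lambda>_. D)) {\<omega>. k \<le> card {i\<in>I. \<omega> i \<in> A} \<and> k \<le> card {i\<in>I. \<omega> i \<in> B}}"
proof -
  let ?P = "Pi_pmf I d (\<lambda>_. D)"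
  let ?a = "measure_pmf.prob D A" and ?b = "measure_pmf.prob D B"
  let ?S = "\<lambda>T. Pi I (\<lambda>i. if i \<in> T then A else B)"
  let ?TT = "{T. T \<subseteq> I \<and> card T = k}"
  have hits: "{i\<in>I. \<omega> i \<in> A} = T" "{i\<in>I. \<omega> i \<in> B} = I - T" if "T \<subseteq> I" "\<omega> \<in> ?S T" for T \<omega>
    using that disj by (auto simp: Pi_iff split: if_splits)
  have "measure_pmf.prob ?P (?S T) = (?a * ?b) ^ k" if T: "T \<in> ?TT" for T
  proof -
    have "card (I - T) = k"
      using T I by (subst card_Diff_subset) (auto intro: finite_subset)
    moreover have "I \<inter> T = T" "I \<inter> - T = I - T" using T by auto
    ultimately have "(\<Prod>i\<in>I. if i \<in> T then ?a else ?b) = (?a * ?b) ^ k"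
      using I(1) T by (simp add: prod.If_cases power_mult_distrib)
    moreover have "(\<Prod>i\<in>I. measure_pmf.prob D (if i \<in> T then A else B)) = (\<Prod>i\<in>I. if i \<in> T then ?a else ?b)"
      by (intro prod.cong) auto
    ultimately show ?thesis
      using I(1) by (simp add: measure_Pi_pmf_Pi)
  qed
  then have "real (2 * k choose k) * (?a * ?b) ^ k = (\<Sum>T\<in>?TT. measure_pmf.prob ?P (?S T))"
    using n_subsets[OF I(1), of k] I(2) by simp
  also have "\<dots> = measure_pmf.prob ?P (\<Union>T\<in>?TT. ?S T)"
  proof (rule measure_pmf.finite_measure_finite_Union[symmetric])
    show "finite ?TT" using I(1) by simp
    show "disjoint_family_on ?S ?TT"
      unfolding disjoint_family_on_def
    proof (intro ballI impI)
      fix T U assume "T \<in> ?TT" "U \<in> ?TT" "T \<noteq> U"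
      then show "?S T \<inter> ?S U = {}" by (metis (no_types, lifting) disjoint_iff hits(1) mem_Collect_eq)
    qed
  qed auto
  also have "\<dots> \<le> measure_pmf.prob ?P {\<omega>. k \<le> card {i\<in>I. \<omega> i \<in> A} \<and> k \<le> card {i\<in>I. \<omega> i \<in> B}}"
  proof (rule measure_pmf.finite_measure_mono)
    show "(\<Union>T\<in>?TT. ?S T) \<subseteq> {\<omega>. k \<le> card {i\<in>I. \<omega> i \<in> A} \<and> k \<le> card {i\<in>I. \<omega> i \<in> B}}"
    proof safe
      fix \<omega> T assume T: "\<omega> \<in> ?S T" "T \<subseteq> I" "k = card T"
      then have "card (I - T) = card T"
        using I by (subst card_Diff_subset) (auto intro: finite_subset)
      then show "card T \<le> card {i\<in>I. \<omega> i \<in> A}" "card T \<le> card {i\<in>I. \<omega> i \<in> B}"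
        using hits[OF T(2,1)] by simp_all
    qed
  qed auto
  finally show ?thesis .
qed

text \<open>Monotonicity, used once in each argument, reduces to the symmetric point
  \<open>1 / 2 - \<delta>\<close>, where the polynomial is already bounded below.\<close>

lemma prob_both_minorities_even_ge:
  assumes I: "finite I" "card I = 2 * k" and k: "k > 0" and disj: "A \<inter> B = {}"
    and A: "measure_pmf.prob D A \<le> 1 / 2 - \<delta>" and B: "measure_pmf.prob D B \<le> 1 / 2 - \<delta>"
    and \<delta>: "0 \<le> \<delta>" "4 * real k * \<delta>\<^sup>2 \<le> 1 / 2"
  shows "real k * \<delta>\<^sup>2 / 2 \<le> measure_pmf.prob (Pi_pmf I d (\<lambda>_. D))
    {\<omega>. card {i\<in>I. \<omega> i \<in> A} < k \<and> card {i\<in>I. \<omega> i \<in> B} < k}"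
proof -
  let ?P = "Pi_pmf I d (\<lambda>_. D)"
  let ?a = "measure_pmf.prob D A" and ?b = "measure_pmf.prob D B"
  let ?U = "{\<omega>. card {i\<in>I. \<omega> i \<in> A} < k}" and ?V = "{\<omega>. card {i\<in>I. \<omega> i \<in> B} < k}"
  have "\<delta> \<le> 1 / 2"
    using order_trans[OF measure_nonneg A] by simp
  have "real k * \<delta>\<^sup>2 / 2 \<le> both_minorities_poly k (1 / 2 - \<delta>) (1 / 2 - \<delta>)"
    using k \<delta> by (rule both_minorities_poly_lower_bound)
  also have "\<dots> \<le> both_minorities_poly k ?a (1 / 2 - \<delta>)"
    using k \<delta> A \<open>\<delta> \<le> 1 / 2\<close> by (intro both_minorities_poly_antimono) auto
  also have "\<dots> = both_minorities_poly k (1 / 2 - \<delta>) ?a"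
    by (rule both_minorities_poly_commute)
  also have "\<dots> \<le> both_minorities_poly k ?b ?a"
    using k \<delta> A B by (intro both_minorities_poly_antimono) auto
  \<comment> \<open>Inclusion-exclusion adds the probability that neither set is a minority, so a
    lower bound for ties suffices.\<close>
  also have "\<dots> \<le> measure_pmf.prob ?P ?U + measure_pmf.prob ?P ?V - 1 + measure_pmf.prob ?P (- ?U \<inter> - ?V)"
    using prob_tie_iid_ge[OF I disj, where D = D and d = d]
    by (simp add: both_minorities_poly_def prob_card_less_iid[OF I(1)] I(2) mult.commute
        Collect_neg_eq[symmetric] Collect_conj_eq[symmetric] not_less)
  also have "\<dots> = measure_pmf.prob ?P (?U \<inter> ?V)"
  proof -
    have "measure_pmf.prob ?P (?U \<union> ?V) = measure_pmf.prob ?P ?U + measure_pmf.prob ?P ?V - measure_pmf.prob ?P (?U \<inter> ?V)"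
      by (rule measure_Un3) (auto simp: measure_pmf.fmeasurable_eq_sets)
    moreover have "- ?U \<inter> - ?V = UNIV - (?U \<union> ?V)" by auto
    then have "measure_pmf.prob ?P (- ?U \<inter> - ?V) = 1 - measure_pmf.prob ?P (?U \<union> ?V)"
      using measure_pmf.prob_compl[of "?U \<union> ?V" ?P] by simp
    ultimately show ?thesis by simp
  qed
  finally show ?thesis by (simp add: Collect_conj_eq)
qed

text \<open>
  An odd sample is completed by one more draw: if a set is hit fewer than \<open>k\<close> times by \<open>2 * k\<close> draws,
  then it is hit by a minority of the first \<open>2 * k - 1\<close>.
\<close>

lemma prob_both_minorities_ge:
  assumes s: "s > 0" and disj: "A \<inter> B = {}"
    and A: "measure_pmf.prob D A \<le> 1 / 2 - \<delta>" and B: "measure_pmf.prob D B \<le> 1 / 2 - \<delta>"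
    and \<delta>: "0 \<le> \<delta>" "4 * real s * \<delta>\<^sup>2 \<le> 1 / 2"
  shows "real s * \<delta>\<^sup>2 / 4 \<le> measure_pmf.prob (iid_samples s D)
    {\<omega>. 2 * card {i\<in>{1..s}. \<omega> i \<in> A} < s \<and> 2 * card {i\<in>{1..s}. \<omega> i \<in> B} < s}"
proof -
  \<comment> \<open>Half of \<open>s\<close> rounded up, so that \<open>2 * k\<close> is
    \<open>s\<close> or \<open>s + 1\<close>.\<close>
  define k where "k = (s + 1) div 2"
  have k: "k > 0" "k \<le> s" "s \<le> 2 * k" "2 * k \<le> s + 1"
    using s by (auto simp: k_def)
  have "real s * \<delta>\<^sup>2 / 4 \<le> real (2 * k) * \<delta>\<^sup>2 / 4"
    using k by (intro divide_right_mono mult_right_mono) (auto simp flip: of_nat_mult)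
  also have "\<dots> = real k * \<delta>\<^sup>2 / 2" by simp
  also have "\<dots> \<le> measure_pmf.prob (Pi_pmf {1..2 * k} undefined (\<lambda>_. D))
      {\<omega>. card {i\<in>{1..2 * k}. \<omega> i \<in> A} < k \<and> card {i\<in>{1..2 * k}. \<omega> i \<in> B} < k}"
  proof (rule prob_both_minorities_even_ge[OF _ _ k(1) disj A B \<delta>(1)])
    have "4 * real k * \<delta>\<^sup>2 \<le> 4 * real s * \<delta>\<^sup>2" using k by (intro mult_right_mono) auto
    then show "4 * real k * \<delta>\<^sup>2 \<le> 1 / 2" using \<delta> by simp
  qed auto
  also have "\<dots> \<le> measure_pmf.prob (iid_samples s D)
    {\<omega>. 2 * card {i\<in>{1..s}. \<omega> i \<in> A} < s \<and> 2 * card {i\<in>{1..s}. \<omega> i \<in> B} < s}"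
  proof -
    have sub: "Pi_pmf {1..s} undefined (\<lambda>_. D) =
        map_pmf (\<lambda>f x. if x \<in> {1..s} then f x else undefined) (Pi_pmf {1..2 * k} undefined (\<lambda>_. D))"
      using k by (intro Pi_pmf_subset) auto
    have le: "card {i\<in>{1..s}. (if i \<in> {1..s} then \<omega> i else undefined) \<in> T} \<le> card {i\<in>{1..2 * k}. \<omega> i \<in> T}"
      for \<omega> :: "nat \<Rightarrow> 'a" and T
      using k by (intro card_mono) auto
    show ?thesis
      unfolding iid_samples_def sub measure_map_pmf
    proof (rule measure_pmf.finite_measure_mono)
      show "{\<omega>. card {i\<in>{1..2 * k}. \<omega> i \<in> A} < k \<and> card {i\<in>{1..2 * k}. \<omega> i \<in> B} < k} \<subseteq>
        (\<lambda>f x. if x \<in> {1..s} then f x else undefined) -`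
        {\<omega>. 2 * card {i\<in>{1..s}. \<omega> i \<in> A} < s \<and> 2 * card {i\<in>{1..s}. \<omega> i \<in> B} < s}"
      proof
        fix \<omega> :: "nat \<Rightarrow> 'a"
        assume "\<omega> \<in> {\<omega>. card {i\<in>{1..2 * k}. \<omega> i \<in> A} < k \<and> card {i\<in>{1..2 * k}. \<omega> i \<in> B} < k}"
        \<comment> \<open>At most \<open>k - 1\<close> hits among all \<open>2 * k\<close> draws
          leave at most \<open>k - 1\<close> among the first \<open>s\<close>, and
          \<open>2 * (k - 1) < s\<close>.\<close>
        then show "\<omega> \<in> (\<lambda>f x. if x \<in> {1..s} then f x else undefined) -`
          {\<omega>. 2 * card {i\<in>{1..s}. \<omega> i \<in> A} < s \<and> 2 * card {i\<in>{1..s}. \<omega> i \<in> B} < s}"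
          using le[of \<omega> A] le[of \<omega> B] k(4) unfolding vimage_def mem_Collect_eq by linarith
      qed
    qed simp
  qed
  finally show ?thesis .
qed

text \<open>A nonpositive sum lies at least \<open>s * \<epsilon>\<close> below its mean, and each
  summand ranges over an interval of length \<open>2 * c\<close>.\<close>

lemma hoeffding_iid_sum_nonpos:
  assumes bounded: "\<And>x. x \<in> set_pmf D \<Longrightarrow> \<bar>h x\<bar> \<le> c" and c: "c > 0"
    and s: "s > 0" and \<epsilon>: "0 \<le> \<epsilon>" "\<epsilon> \<le> measure_pmf.expectation D h"
  shows "measure_pmf.prob (iid_samples s D) {\<omega>. (\<Sum>j=1..s. h (\<omega> j)) \<le> 0} \<le>
    exp (- (real s * \<epsilon>\<^sup>2 / (2 * c\<^sup>2)))"
proof -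
  let ?P = "Pi_pmf {1..s} undefined (\<lambda>_. D)"
  have mean: "measure_pmf.expectation ?P (\<lambda>\<omega>. h (\<omega> j)) = measure_pmf.expectation D h" if "j \<in> {1..s}" for j
  proof -
    have "D = map_pmf (\<lambda>\<omega>. \<omega> j) ?P" using that by (subst Pi_pmf_component) auto
    then have "measure_pmf.expectation D h = measure_pmf.expectation (map_pmf (\<lambda>\<omega>. \<omega> j) ?P) h"
      by simp
    then show ?thesis by simp
  qed
  interpret H: Hoeffding_ineq "measure_pmf ?P" "{1..s}" "\<lambda>j \<omega>. h (\<omega> j)" "\<lambda>_. - c" "\<lambda>_. c"
    "real s * measure_pmf.expectation D h"
  proof unfold_locales
    show "prob_space.indep_vars (measure_pmf ?P) (\<lambda>_. borel) (\<lambda>j \<omega>. h (\<omega> j)) {1..s}"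
      by (rule prob_space.indep_vars_compose2[OF measure_pmf.prob_space_axioms indep_vars_Pi_pmf]) auto
    show "AE \<omega> in measure_pmf ?P. h (\<omega> j) \<in> {- c..c}" if "j \<in> {1..s}" for j
      using bounded that by (force simp: AE_measure_pmf_iff set_Pi_pmf PiE_dflt_def abs_le_iff)
    show "real s * measure_pmf.expectation D h \<equiv> \<Sum>j\<in>{1..s}. measure_pmf.expectation ?P (\<lambda>\<omega>. h (\<omega> j))"
      by (rule eq_reflection) (simp add: mean del: One_nat_def)
  qed simp
  have "{\<omega>. (\<Sum>j=1..s. h (\<omega> j)) \<le> 0} \<subseteq>
      {\<omega>. (\<Sum>j=1..s. h (\<omega> j)) \<le> real s * measure_pmf.expectation D h - real s * \<epsilon>}"
    using mult_left_mono[OF \<epsilon>(2), of "real s"] by auto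
  then have "measure_pmf.prob ?P {\<omega>. (\<Sum>j=1..s. h (\<omega> j)) \<le> 0} \<le>
      measure_pmf.prob ?P {\<omega>. (\<Sum>j=1..s. h (\<omega> j)) \<le> real s * measure_pmf.expectation D h - real s * \<epsilon>}"
    by (intro measure_pmf.finite_measure_mono) auto
  also have "\<dots> \<le> exp (- 2 * (real s * \<epsilon>)\<^sup>2 / (\<Sum>j\<in>{1..s}. (c - - c)\<^sup>2))"
    using H.Hoeffding_ineq_le[of "real s * \<epsilon>"] \<epsilon> c s by simp
  also have "- 2 * (real s * \<epsilon>)\<^sup>2 / (\<Sum>j\<in>{1..s}. (c - - c)\<^sup>2) = - (real s * \<epsilon>\<^sup>2 / (2 * c\<^sup>2))"
    using c s by (simp add: power2_eq_square divide_simps)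
  finally show ?thesis unfolding iid_samples_def .
qed

subsection \<open>Empirical medians\<close>

definition mean_abs_dev :: "'a pmf \<Rightarrow> ('a \<Rightarrow> real) \<Rightarrow> real \<Rightarrow> real" where
  "mean_abs_dev D X x = measure_pmf.expectation D (\<lambda>\<omega>. \<bar>x - X \<omega>\<bar>)"

text \<open>The factor \<open>1 / s\<close> of the empirical loss is left out, as it does not affect
  comparisons between points.\<close>

definition total_abs_dev :: "nat \<Rightarrow> ('a \<Rightarrow> real) \<Rightarrow> (nat \<Rightarrow> 'a) \<Rightarrow> real \<Rightarrow> real" where
  "total_abs_dev s X \<omega> x = (\<Sum>j=1..s. \<bar>x - X (\<omega> j)\<bar>)"

lemma integrable_measure_pmf_bounded:
  fixes f :: "'a \<Rightarrow> real"
  assumes "\<And>x. x \<in> set_pmf D \<Longrightarrow> \<bar>f x\<bar> \<le> B"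
  shows "integrable (measure_pmf D) f"
  using assms by (intro measure_pmf.integrable_const_bound[where B = B]) (auto simp: AE_measure_pmf_iff)

lemma integrable_abs_dev:
  fixes X :: "'a \<Rightarrow> real"
  assumes "\<forall>\<omega>\<in>set_pmf D. 0 \<le> X \<omega> \<and> X \<omega> \<le> c"
  shows "integrable (measure_pmf D) (\<lambda>\<omega>. \<bar>x - X \<omega>\<bar>)"
  by (rule integrable_measure_pmf_bounded[where B = "\<bar>x\<bar> + c"]) (use assms in fastforce)

lemma mean_abs_dev_diff:
  assumes "\<forall>\<omega>\<in>set_pmf D. 0 \<le> X \<omega> \<and> X \<omega> \<le> c"
  shows "mean_abs_dev D X y - mean_abs_dev D X x =
    measure_pmf.expectation D (\<lambda>\<omega>. \<bar>y - X \<omega>\<bar> - \<bar>x - X \<omega>\<bar>)"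
  unfolding mean_abs_dev_def
  by (rule Bochner_Integration.integral_diff[symmetric]; rule integrable_abs_dev[OF assms])

text \<open>The triangle inequality under the expectation. It will show that the first bad value
  next to an acceptable one exceeds the latter's loss by at most \<open>1\<close>.\<close>

lemma mean_abs_dev_le_add_dist:
  assumes "\<forall>\<omega>\<in>set_pmf D. 0 \<le> X \<omega> \<and> X \<omega> \<le> c"
  shows "mean_abs_dev D X y \<le> mean_abs_dev D X x + \<bar>y - x\<bar>"
proof -
  have "mean_abs_dev D X y - mean_abs_dev D X x \<le> measure_pmf.expectation D (\<lambda>_. \<bar>y - x\<bar>)"
    unfolding mean_abs_dev_diff[where D = D and X = X, OF assms]
    by (intro integral_mono Bochner_Integration.integrable_diff integrable_abs_dev[OF assms]) auto
  then show ?thesis by simp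
qed

text \<open>By convexity, the value at a point between two others is at most the larger of the two
  end values.\<close>

lemma total_abs_dev_quasiconvex:
  assumes between: "x \<le> y \<and> y \<le> z \<or> z \<le> y \<and> y \<le> x"
    and le: "total_abs_dev s X \<omega> z \<le> total_abs_dev s X \<omega> x"
  shows "total_abs_dev s X \<omega> y \<le> total_abs_dev s X \<omega> x"
proof -
  obtain u where u: "0 \<le> u" "u \<le> 1" and y: "y = (1 - u) * x + u * z"
  proof (cases "x = z")
    case True
    with between show ?thesis by (intro that[of 0]) auto
  next
    case False
    with between show ?thesis
    proof (intro that[of "(y - x) / (z - x)"])
      show "y = (1 - (y - x) / (z - x)) * x + (y - x) / (z - x) * z"
        using False by (simp add: divide_simps) (simp add: algebra_simps)
    qed (auto simp: divide_simps)
  qed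
  have "total_abs_dev s X \<omega> y \<le> (\<Sum>j=1..s. (1 - u) * \<bar>x - X (\<omega> j)\<bar> + u * \<bar>z - X (\<omega> j)\<bar>)"
    unfolding total_abs_dev_def
  proof (rule sum_mono)
    fix j
    have "y - X (\<omega> j) = (1 - u) * (x - X (\<omega> j)) + u * (z - X (\<omega> j))"
      unfolding y by (simp add: algebra_simps)
    then show "\<bar>y - X (\<omega> j)\<bar> \<le> (1 - u) * \<bar>x - X (\<omega> j)\<bar> + u * \<bar>z - X (\<omega> j)\<bar>"
      using u abs_triangle_ineq[of "(1 - u) * (x - X (\<omega> j))" "u * (z - X (\<omega> j))"]
      by (simp add: abs_mult)
  qed
  also have "\<dots> = (1 - u) * total_abs_dev s X \<omega> x + u * total_abs_dev s X \<omega> z"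
    by (simp add: total_abs_dev_def sum.distrib sum_distrib_left)
  also have "\<dots> \<le> (1 - u) * total_abs_dev s X \<omega> x + u * total_abs_dev s X \<omega> x"
    using u le by (intro add_mono mult_left_mono) auto
  finally show ?thesis by (simp add: algebra_simps)
qed

text \<open>Hoeffding's inequality for
  \<open>\<bar>y - X \<omega>\<bar> - \<bar>x - X \<omega>\<bar>\<close>, which is bounded by
  \<open>r\<close> and has mean at least \<open>\<epsilon>\<close>. The separate bound
  \<open>M\<close> allows one exponent for all edges.\<close>

lemma prob_total_abs_dev_le:
  assumes X: "\<forall>\<omega>\<in>set_pmf D. 0 \<le> X \<omega> \<and> X \<omega> \<le> c"
    and dist: "\<bar>y - x\<bar> \<le> r" and r: "r > 0" "r\<^sup>2 \<le> M" and s: "s > 0" and \<epsilon>: "0 \<le> \<epsilon>"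
    and gap: "mean_abs_dev D X x + \<epsilon> \<le> mean_abs_dev D X y"
  shows "measure_pmf.prob (iid_samples s D) {\<omega>. total_abs_dev s X \<omega> y \<le> total_abs_dev s X \<omega> x} \<le>
    exp (- (real s * \<epsilon>\<^sup>2 / (2 * M)))"
proof -
  have "measure_pmf.prob (iid_samples s D) {\<omega>. (\<Sum>j=1..s. \<bar>y - X (\<omega> j)\<bar> - \<bar>x - X (\<omega> j)\<bar>) \<le> 0} \<le>
      exp (- (real s * \<epsilon>\<^sup>2 / (2 * r\<^sup>2)))"
    using gap dist
    by (intro hoeffding_iid_sum_nonpos[OF _ r(1) s \<epsilon>])
       (auto simp: mean_abs_dev_diff[symmetric, where D = D and X = X, OF X])
  also have "\<dots> \<le> exp (- (real s * \<epsilon>\<^sup>2 / (2 * M)))"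
    using r by (auto intro!: divide_left_mono simp: zero_less_mult_iff intro: less_le_trans[OF zero_less_power[OF r(1)]])
  finally show ?thesis by (simp add: total_abs_dev_def sum_subtractf)
qed

text \<open>The two points to test are \<open>Min R\<close> and \<open>Max L\<close>, the bad values
  nearest to \<open>x\<close>. One of them lies between \<open>x\<close> and any bad minimizer
  \<open>z\<close>, so by quasiconvexity its empirical deviation is at most that at
  \<open>x\<close>.\<close>

lemma prob_empirical_median_bad_le:
  fixes c x :: nat
  assumes X: "\<forall>\<omega>\<in>set_pmf D. 0 \<le> X \<omega> \<and> X \<omega> \<le> real c"
    and M: "(real c)\<^sup>2 \<le> M" and s: "s > 0" and \<epsilon>: "0 < \<epsilon>" and x: "x \<le> c"
  shows "measure_pmf.prob (iid_samples s D)
     {\<omega>. \<exists>z\<le>c. (\<forall>y\<le>c. total_abs_dev s X \<omega> (real z) \<le> total_abs_dev s X \<omega> (real y)) \<and>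
        mean_abs_dev D X (real x) + \<epsilon> < mean_abs_dev D X (real z)} \<le>
    2 * exp (- (real s * \<epsilon>\<^sup>2 / (2 * M)))" (is "measure _ ?bad \<le> 2 * ?E")
proof -
  let ?prob = "measure_pmf.prob (iid_samples s D)"
  let ?g = "\<lambda>y. mean_abs_dev D X (real y)" and ?t = "\<lambda>\<omega> y. total_abs_dev s X \<omega> (real y)"
  define R where "R = {y. x < y \<and> y \<le> c \<and> ?g x + \<epsilon> < ?g y}"
  define L where "L = {y. y < x \<and> ?g x + \<epsilon> < ?g y}"
  have fin: "finite R" "finite L" by (auto simp: R_def L_def)
  note R_iff = R_def[unfolded set_eq_iff mem_Collect_eq, rule_format]
    and L_iff = L_def[unfolded set_eq_iff mem_Collect_eq, rule_format]
  \<comment> \<open>The condition \<open>S \<noteq> {}\<close> makes the event empty on a side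
    without bad values, where \<open>Min\<close> or \<open>Max\<close> would be meaningless.\<close>
  have tail: "?prob {\<omega>. S \<noteq> {} \<and> ?t \<omega> y \<le> ?t \<omega> x} \<le> ?E" if "S \<noteq> {} \<Longrightarrow> y \<in> R \<union> L" for S y
  proof (cases "S = {}")
    case False
    with that have y: "y \<in> R \<union> L" by blast
    \<comment> \<open>A bad value differs from \<open>x\<close> within \<open>{0..c}\<close>, which
      forces \<open>c\<close> to be positive as the Hoeffding bound requires.\<close>
    have "\<bar>real y - real x\<bar> \<le> real c" "0 < real c" and gap: "?g x + \<epsilon> \<le> ?g y"
      using y x by (auto simp: R_iff L_iff)
    then show ?thesis
      using False prob_total_abs_dev_le[OF X, of "real y" "real x" "real c" M s \<epsilon>] M s \<epsilon> by simp
  qed simp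
  have "?bad \<subseteq> {\<omega>. R \<noteq> {} \<and> ?t \<omega> (Min R) \<le> ?t \<omega> x} \<union> {\<omega>. L \<noteq> {} \<and> ?t \<omega> (Max L) \<le> ?t \<omega> x}"
  proof
    fix \<omega> assume "\<omega> \<in> ?bad"
    then obtain z where z: "z \<le> c" "\<And>y. y \<le> c \<Longrightarrow> ?t \<omega> z \<le> ?t \<omega> y" "?g x + \<epsilon> < ?g z" by auto
    have "z \<noteq> x" using z(3) \<epsilon> by auto
    then consider "z \<in> R" | "z \<in> L"
      using z by (cases "z < x") (auto simp: R_iff L_iff)
    then show "\<omega> \<in> {\<omega>. R \<noteq> {} \<and> ?t \<omega> (Min R) \<le> ?t \<omega> x} \<union> {\<omega>. L \<noteq> {} \<and> ?t \<omega> (Max L) \<le> ?t \<omega> x}"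
    proof cases
      case 1
      then have "Min R \<le> z" "Min R \<in> R" using Min_le[OF fin(1)] Min_in[OF fin(1)] by blast+
      then have "?t \<omega> (Min R) \<le> ?t \<omega> x"
        using z(2)[OF x] total_abs_dev_quasiconvex[of "real x" "real (Min R)" "real z" s X \<omega>]
        by (auto simp: R_iff)
      with 1 show ?thesis by auto
    next
      case 2
      then have "z \<le> Max L" "Max L \<in> L" using Max_ge[OF fin(2)] Max_in[OF fin(2)] by blast+
      then have "?t \<omega> (Max L) \<le> ?t \<omega> x"
        using z(2)[OF x] total_abs_dev_quasiconvex[of "real x" "real (Max L)" "real z" s X \<omega>]
        by (auto simp: L_iff)
      with 2 show ?thesis by auto
    qed
  qed
  then have "?prob ?bad \<le> ?prob ({\<omega>. R \<noteq> {} \<and> ?t \<omega> (Min R) \<le> ?t \<omega> x} \<union> {\<omega>. L \<noteq> {} \<and> ?t \<omega> (Max L) \<le> ?t \<omega> x})"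
    by (intro measure_pmf.finite_measure_mono) auto
  also have "\<dots> \<le> ?prob {\<omega>. R \<noteq> {} \<and> ?t \<omega> (Min R) \<le> ?t \<omega> x} + ?prob {\<omega>. L \<noteq> {} \<and> ?t \<omega> (Max L) \<le> ?t \<omega> x}"
    by (rule measure_Un_le) auto
  also have "\<dots> \<le> ?E + ?E"
    using fin by (intro add_mono tail) (auto intro: Min_in Max_in)
  finally show ?thesis by simp
qed

section \<open>Small samples: medians confined by minorities\<close>

text \<open>Put \<open>d = \<sigma> * (y - x)\<close>. Moving from \<open>x\<close> to
  \<open>y\<close> raises the deviation by at most \<open>d\<close> where \<open>X\<close> lies
  before \<open>y\<close>, and lowers it by exactly \<open>d\<close> where \<open>X\<close> is at or
  beyond \<open>y\<close>. A mean increase above \<open>1\<close> hence forces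
  \<open>1 < d * (1 - 2 * P)\<close> for the probability \<open>P\<close> in question. The sign
  \<open>\<sigma>\<close> treats both directions at once.\<close>

lemma prob_beyond_point_le:
  assumes X: "\<forall>\<omega>\<in>set_pmf D. 0 \<le> X \<omega> \<and> X \<omega> \<le> b"
    and sgn: "\<sigma> = 1 \<or> \<sigma> = - 1" and dist: "0 < \<sigma> * (y - x)" "\<sigma> * (y - x) \<le> c"
    and gap: "mean_abs_dev D X x + 1 < mean_abs_dev D X y"
  shows "measure_pmf.prob D {\<omega>. 0 \<le> \<sigma> * (X \<omega> - y)} \<le> 1 / 2 - 1 / (2 * c)"
proof -
  let ?d = "\<sigma> * (y - x)" and ?B = "{\<omega>. 0 \<le> \<sigma> * (X \<omega> - y)}"
  have c: "c > 0" using dist by simp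
  have "1 < mean_abs_dev D X y - mean_abs_dev D X x" using gap by simp
  also have "\<dots> \<le> measure_pmf.expectation D (\<lambda>\<omega>. ?d - 2 * ?d * indicator ?B \<omega>)"
    unfolding mean_abs_dev_diff[where D = D and X = X, OF X]
  proof (rule integral_mono)
    show "integrable D (\<lambda>\<omega>. ?d - 2 * ?d * indicator ?B \<omega>)"
      by (rule integrable_measure_pmf_bounded[where B = "\<bar>?d\<bar>"]) (auto simp: indicator_def)
    show "\<bar>y - X \<omega>\<bar> - \<bar>x - X \<omega>\<bar> \<le> ?d - 2 * ?d * indicator ?B \<omega>" for \<omega>
      using sgn dist(1) by (auto simp: indicator_def)
  qed (intro Bochner_Integration.integrable_diff integrable_abs_dev[OF X])
  also have "\<dots> = ?d - 2 * ?d * measure_pmf.prob D ?B"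
    by (subst Bochner_Integration.integral_diff) (auto intro!: integrable_measure_pmf_bounded[where B = 1])
  finally have *: "1 < ?d * (1 - 2 * measure_pmf.prob D ?B)" by (simp add: algebra_simps)
  then have "0 < 1 - 2 * measure_pmf.prob D ?B"
    using dist(1) by (smt (verit) mult_nonneg_nonpos)
  then have "?d * (1 - 2 * measure_pmf.prob D ?B) \<le> c * (1 - 2 * measure_pmf.prob D ?B)"
    using dist by (intro mult_right_mono) auto
  with * have "1 < c * (1 - 2 * measure_pmf.prob D ?B)" by simp
  then show ?thesis using c by (simp add: field_simps)
qed

text \<open>The same computation with counts: moving on from \<open>y\<close> to \<open>x\<close>
  costs the full distance for each sample before \<open>y\<close> and gains at most that distance
  for each of the others, which are fewer.\<close>

lemma total_abs_dev_less_of_minority: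
  assumes sgn: "\<sigma> = 1 \<or> \<sigma> = - 1" and beyond: "0 < \<sigma> * (x - y)"
    and minority: "2 * card {j\<in>{1..s}. 0 \<le> \<sigma> * (X (\<omega> j) - y)} < s"
  shows "total_abs_dev s X \<omega> y < total_abs_dev s X \<omega> x"
proof -
  let ?d = "\<sigma> * (x - y)" and ?B = "{j\<in>{1..s}. 0 \<le> \<sigma> * (X (\<omega> j) - y)}"
  have "real (2 * card ?B) < real s"
    using minority by (simp only: of_nat_less_iff)
  then have "0 < ?d * (real s - 2 * real (card ?B))"
    by (intro mult_pos_pos[OF beyond]) simp
  also have "\<dots> = (\<Sum>j=1..s. ?d - 2 * ?d * (if 0 \<le> \<sigma> * (X (\<omega> j) - y) then 1 else 0))"
  proof -
    have "real (card ?B) = (\<Sum>j=1..s. if 0 \<le> \<sigma> * (X (\<omega> j) - y) then 1 else 0)"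
      by (subst sum.inter_filter[symmetric]) auto
    then show ?thesis
      by (simp only: sum_subtractf sum_distrib_left[symmetric]) (simp add: algebra_simps)
  qed
  also have "\<dots> \<le> (\<Sum>j=1..s. \<bar>x - X (\<omega> j)\<bar> - \<bar>y - X (\<omega> j)\<bar>)"
  proof (rule sum_mono)
    fix j
    show "?d - 2 * ?d * (if 0 \<le> \<sigma> * (X (\<omega> j) - y) then 1 else 0) \<le> \<bar>x - X (\<omega> j)\<bar> - \<bar>y - X (\<omega> j)\<bar>"
      using sgn beyond by (cases "0 \<le> \<sigma> * (X (\<omega> j) - y)") auto
  qed
  finally show ?thesis by (simp add: total_abs_dev_def sum_subtractf)
qed

text \<open>Bad values are defined with threshold \<open>1\<close>, so that less than half of the
  mass lies beyond the nearest ones. These are themselves within \<open>2\<close> of the loss at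
  \<open>x\<close>, and if neither side holds half of the samples, no minimizer lies strictly beyond
  them.\<close>

lemma prob_empirical_median_good_ge:
  fixes c x :: nat
  assumes X: "\<forall>\<omega>\<in>set_pmf D. 0 \<le> X \<omega> \<and> X \<omega> \<le> real c"
    and s: "s > 0" "real s \<le> (real c)\<^sup>2" and x: "x \<le> c"
  shows "real s / (64 * (real c)\<^sup>2) \<le> measure_pmf.prob (iid_samples s D)
     {\<omega>. \<forall>z\<le>c. (\<forall>y\<le>c. total_abs_dev s X \<omega> (real z) \<le> total_abs_dev s X \<omega> (real y)) \<longrightarrow>
        mean_abs_dev D X (real z) \<le> mean_abs_dev D X (real x) + 2}" (is "_ \<le> measure _ ?good")
proof -
  let ?prob = "measure_pmf.prob (iid_samples s D)"
  let ?g = "\<lambda>y. mean_abs_dev D X (real y)" and ?t = "\<lambda>\<omega> y. total_abs_dev s X \<omega> (real y)"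
  define R where "R = {y. x < y \<and> y \<le> c \<and> ?g x + 1 < ?g y}"
  define L where "L = {y. y < x \<and> ?g x + 1 < ?g y}"
  define A where "A = {\<omega>. L \<noteq> {} \<and> 0 \<le> - 1 * (X \<omega> - real (Max L))}"
  define B where "B = {\<omega>. R \<noteq> {} \<and> 0 \<le> 1 * (X \<omega> - real (Min R))}"
  have fin: "finite R" "finite L" by (auto simp: R_def L_def)
  note R_iff = R_def[unfolded set_eq_iff mem_Collect_eq, rule_format]
    and L_iff = L_def[unfolded set_eq_iff mem_Collect_eq, rule_format]
  have inR: "Min R \<in> R" if "R \<noteq> {}" using that fin by (auto intro: Min_in)
  have inL: "Max L \<in> L" if "L \<noteq> {}" using that fin by (auto intro: Max_in)
  have c: "c > 0" using s by (cases c) auto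
  \<comment> \<open>Half of the available margin \<open>1 / (2 * c)\<close>: with
    \<open>s \<le> c\<^sup>2\<close> this gives \<open>4 * s * \<delta>\<^sup>2 \<le> 1 / 4\<close>,
    and \<open>s * \<delta>\<^sup>2 / 4\<close> yields the constant \<open>64\<close>.\<close>
  define \<delta> where "\<delta> = 1 / (4 * real c)"
  have \<delta>: "0 \<le> \<delta>" "\<delta> \<le> 1 / (2 * real c)" "1 / (2 * real c) \<le> 1 / 2"
    using c by (auto simp: \<delta>_def field_simps)
  have disj: "A \<inter> B = {}"
  proof -
    have "real (Max L) < real (Min R)" if "L \<noteq> {}" "R \<noteq> {}"
      using inL[OF that(1)] inR[OF that(2)] by (simp add: R_iff L_iff)
    then show ?thesis by (force simp: A_def B_def)
  qed
  have A: "measure_pmf.prob D A \<le> 1 / 2 - \<delta>"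
  proof (cases "L = {}")
    case False
    then have "measure_pmf.prob D A \<le> 1 / 2 - 1 / (2 * real c)"
      unfolding A_def using inL x by (simp, intro prob_beyond_point_le[OF X, where \<sigma> = "- 1", simplified]) (auto simp: L_iff)
    then show ?thesis using \<delta> by simp
  qed (use \<delta> in \<open>simp add: A_def\<close>)
  have B: "measure_pmf.prob D B \<le> 1 / 2 - \<delta>"
  proof (cases "R = {}")
    case False
    then have "measure_pmf.prob D B \<le> 1 / 2 - 1 / (2 * real c)"
      unfolding B_def using inR x by (simp, intro prob_beyond_point_le[OF X, where \<sigma> = 1, simplified]) (auto simp: R_iff)
    then show ?thesis using \<delta> by simp
  qed (use \<delta> in \<open>simp add: B_def\<close>)
  have "real s / (64 * (real c)\<^sup>2) = real s * \<delta>\<^sup>2 / 4"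
    by (simp add: \<delta>_def power2_eq_square)
  also have "\<dots> \<le> ?prob {\<omega>. 2 * card {i\<in>{1..s}. \<omega> i \<in> A} < s \<and> 2 * card {i\<in>{1..s}. \<omega> i \<in> B} < s}"
  proof (rule prob_both_minorities_ge[OF s(1) disj A B \<delta>(1)])
    show "4 * real s * \<delta>\<^sup>2 \<le> 1 / 2"
      using s(2) c by (simp add: \<delta>_def power2_eq_square field_simps)
  qed
  also have "\<dots> \<le> ?prob ?good"
  proof (intro measure_pmf.finite_measure_mono subsetI)
    fix \<omega> assume "\<omega> \<in> {\<omega>. 2 * card {i\<in>{1..s}. \<omega> i \<in> A} < s \<and> 2 * card {i\<in>{1..s}. \<omega> i \<in> B} < s}"
    then have minor: "2 * card {i\<in>{1..s}. \<omega> i \<in> A} < s" "2 * card {i\<in>{1..s}. \<omega> i \<in> B} < s" by auto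
    have "?g z \<le> ?g x + 2" if z: "z \<le> c" "\<forall>y\<le>c. ?t \<omega> z \<le> ?t \<omega> y" for z
    proof (rule ccontr)
      assume bad: "\<not> ?g z \<le> ?g x + 2"
      then have "z \<noteq> x" by auto
      with bad z(1) consider "z \<in> R" | "z \<in> L"
        by (cases "z < x") (auto simp: R_iff L_iff)
      then show False
      proof cases
        case 1
        then have R: "R \<noteq> {}" "Min R \<le> z" using fin by auto
        note minR = inR[OF R(1)]
        have "?g (Min R) \<le> ?g x + 2"
        proof -
          \<comment> \<open>Since \<open>x < Min R\<close>, the predecessor is a genuine one and is
            still at least \<open>x\<close>, so its loss is within \<open>1\<close> of that at
            \<open>x\<close>.\<close>
          have "Min R - 1 \<notin> R"
            using Min_le[OF fin(1), of "Min R - 1"] minR by (force simp: R_iff)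
          then have "?g (Min R - 1) \<le> ?g x + 1"
            using minR by (cases "Min R - 1 = x") (auto simp: R_iff)
          moreover have "?g (Min R) \<le> ?g (Min R - 1) + \<bar>real (Min R) - real (Min R - 1)\<bar>"
            by (rule mean_abs_dev_le_add_dist[OF X])
          ultimately show ?thesis using minR by (auto simp: R_iff)
        qed
        with bad R(2) have "Min R < z" by (cases "Min R = z") auto
        then have "?t \<omega> (Min R) < ?t \<omega> z"
          using minor(2) R by (intro total_abs_dev_less_of_minority[where \<sigma> = 1]) (auto simp: B_def)
        moreover have "Min R \<le> c" using minR by (auto simp: R_iff)
        ultimately show False using z(2) by force
      next
        case 2
        then have L: "L \<noteq> {}" "z \<le> Max L" using fin by auto
        note maxL = inL[OF L(1)]
        have "?g (Max L) \<le> ?g x + 2"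
        proof -
          have "Max L + 1 \<notin> L"
            using Max_ge[OF fin(2), of "Max L + 1"] by force
          then have "?g (Max L + 1) \<le> ?g x + 1"
            using maxL by (cases "Max L + 1 = x") (auto simp: L_iff)
          moreover have "?g (Max L) \<le> ?g (Max L + 1) + \<bar>real (Max L) - real (Max L + 1)\<bar>"
            by (rule mean_abs_dev_le_add_dist[OF X])
          ultimately show ?thesis by simp
        qed
        with bad L(2) have "z < Max L" by (cases "Max L = z") auto
        then have "?t \<omega> (Max L) < ?t \<omega> z"
          using minor(1) L by (intro total_abs_dev_less_of_minority[where \<sigma> = "- 1"]) (auto simp: A_def)
        moreover have "Max L \<le> c" using maxL x by (auto simp: L_iff)
        ultimately show False using z(2) by force
      qed
    qed
    then show "\<omega> \<in> ?good" by blast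
  qed simp
  finally show ?thesis .
qed

subsection \<open>Separable minimization over the edges\<close>

text \<open>Replacing a single coordinate stays inside the product, so an improvable coordinate
  would contradict minimality. The negated form suits an order that need not be linear.\<close>

lemma is_arg_min_sum_PiE_D:
  fixes h :: "'e \<Rightarrow> 'a \<Rightarrow> 'b::ordered_cancel_comm_monoid_add"
  assumes fin: "finite I"
    and min: "is_arg_min (\<lambda>f. \<Sum>e\<in>I. h e (f e)) (\<lambda>f. f \<in> Pi\<^sub>E I S) f"
    and e: "e \<in> I" and x: "x \<in> S e"
  shows "\<not> h e x < h e (f e)"
proof
  assume less: "h e x < h e (f e)"
  let ?f = "f(e := x)"
  have "f \<in> Pi\<^sub>E I S" using min by (simp add: is_arg_min_def)
  then have "?f \<in> Pi\<^sub>E I S" using e x by (auto simp: PiE_iff extensional_def)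
  moreover have "(\<Sum>i\<in>I. h i (?f i)) < (\<Sum>i\<in>I. h i (f i))"
    using fin e less by (simp add: sum.remove[OF fin e] add_strict_right_mono)
  ultimately show False using min unfolding is_arg_min_def by blast
qed

lemma is_max_flow_bounds:
  assumes "is_max_flow G src snk c f" "e \<in> arcs G"
  shows "0 \<le> f e" "f e \<le> real (c e)"
  using assms by (auto simp: is_max_flow_def is_arg_max_def is_flow_def)

text \<open>The bounds make each \<open>fstar c' e\<close> a random variable with values in
  \<open>[0, c e]\<close>, which is the setting of the median lemmas.\<close>

locale flow_sampling = fin_digraph G
  for G :: "('v, 'e) pre_digraph" +
  fixes c :: "'e \<Rightarrow> nat" and fstar :: "('e \<Rightarrow> nat) \<Rightarrow> 'e \<Rightarrow> real" and D :: "('e \<Rightarrow> nat) pmf"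
  assumes fstar_bounds: "\<And>e. e \<in> arcs G \<Longrightarrow> \<forall>c'\<in>set_pmf D. 0 \<le> fstar c' e \<and> fstar c' e \<le> real (c e)"
begin

abbreviation edge_loss :: "'e \<Rightarrow> nat \<Rightarrow> real" where
  "edge_loss e x \<equiv> mean_abs_dev D (\<lambda>c'. fstar c' e) (real x)"

abbreviation edge_total :: "nat \<Rightarrow> (nat \<Rightarrow> 'e \<Rightarrow> nat) \<Rightarrow> 'e \<Rightarrow> nat \<Rightarrow> real" where
  "edge_total s cs e x \<equiv> total_abs_dev s (\<lambda>c'. fstar c' e) cs (real x)"

lemma expected_loss_eq: "expected_loss G fstar D f = (\<Sum>e\<in>arcs G. edge_loss e (f e))"
  unfolding expected_loss_def l1_dist_def mean_abs_dev_def
  by (rule Bochner_Integration.integral_sum) (rule integrable_abs_dev[OF fstar_bounds])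

lemma empirical_loss_eq:
  "empirical_loss G fstar s cs f = (\<Sum>e\<in>arcs G. 1 / real s * edge_total s cs e (f e))"
  unfolding empirical_loss_def l1_dist_def total_abs_dev_def
  by (subst sum.swap) (simp add: sum_distrib_left)

text \<open>The box is a product and the empirical loss a sum over edges, so an empirical minimizer
  restricts to an empirical median on every edge.\<close>

lemma empirical_minimizer_edge:
  assumes s: "s > 0" and min: "is_arg_min (empirical_loss G fstar s cs) (\<lambda>f. f \<in> integral_box G c) f"
    and e: "e \<in> arcs G"
  shows "f e \<le> c e" "\<And>y. y \<le> c e \<Longrightarrow> edge_total s cs e (f e) \<le> edge_total s cs e y"
proof -
  show "f e \<le> c e"
    using min e by (auto simp: is_arg_min_def integral_box_def PiE_iff)
  have "empirical_loss G fstar s cs = (\<lambda>f. \<Sum>e\<in>arcs G. 1 / real s * edge_total s cs e (f e))"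
    by (rule ext) (rule empirical_loss_eq)
  with min have "is_arg_min (\<lambda>f. \<Sum>e\<in>arcs G. 1 / real s * edge_total s cs e (f e))
      (\<lambda>f. f \<in> (\<Pi>\<^sub>E e\<in>arcs G. {0..c e})) f"
    by (simp only: integral_box_def)
  from is_arg_min_sum_PiE_D[OF _ this e]
  show "edge_total s cs e (f e) \<le> edge_total s cs e y" if "y \<le> c e" for y
    using s that by (force simp: divide_less_cancel not_less)
qed

text \<open>The excess \<open>2\<close> is divided into \<open>2 / m\<close> per edge. Each edge
  fails with probability at most \<open>2 * (p / m)\<^sup>2\<close>, and the union bound gives
  \<open>2 * p\<^sup>2 / m\<close>.\<close>

lemma prob_empirical_minimizer_ge:
  assumes ft: "ft \<in> integral_box G c"
    and M: "\<And>e. e \<in> arcs G \<Longrightarrow> (real (c e))\<^sup>2 \<le> M" "0 < M"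
    and p: "0 < p" "p < 1" "2 \<le> card (arcs G) \<or> p \<le> 1 / 2" and ne: "arcs G \<noteq> {}"
    and s: "M * (real (card (arcs G)))\<^sup>2 * (ln (real (card (arcs G))) + ln (1 / p)) \<le> real s"
  shows "1 - p \<le> measure_pmf.prob (iid_samples s D)
    {cs. \<forall>fhat. is_arg_min (empirical_loss G fstar s cs) (\<lambda>f. f \<in> integral_box G c) fhat \<longrightarrow>
           expected_loss G fstar D fhat \<le> expected_loss G fstar D ft + 2}" (is "_ \<le> measure _ ?good")
proof -
  let ?P = "iid_samples s D"
  define m where "m = real (card (arcs G))"
  have m: "1 \<le> m"
    using ne by (simp add: m_def Suc_le_eq card_gt_0_iff)
  have ln_pos: "0 < ln m + ln (1 / p)" using m p by (intro add_nonneg_pos) auto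
  have s': "M * m\<^sup>2 * (ln m + ln (1 / p)) \<le> real s" using s by (simp add: m_def)
  have "0 < M * m\<^sup>2 * (ln m + ln (1 / p))" using ln_pos m M by (intro mult_pos_pos) auto
  with s' have s0: "s > 0" by (simp add: less_le_trans)
  define bad where "bad e = {cs. \<exists>z\<le>c e. (\<forall>y\<le>c e. edge_total s cs e z \<le> edge_total s cs e y) \<and>
      edge_loss e (ft e) + 2 / m < edge_loss e z}" for e
  have "measure_pmf.prob ?P (bad e) \<le> 2 * (p / m)\<^sup>2" if e: "e \<in> arcs G" for e
  proof -
    \<comment> \<open>The coefficient \<open>2\<close> in the exponent produces the square of
      \<open>p / m\<close>, whose extra factor has to absorb the \<open>2\<close> from the two
      sides.\<close>
    have "2 * (ln m + ln (1 / p)) \<le> real s * (2 / m)\<^sup>2 / (2 * M)"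
    proof -
      have "ln m + ln (1 / p) \<le> real s / (M * m\<^sup>2)"
        using s' m M by (subst pos_le_divide_eq) (auto simp: mult.commute)
      moreover have "real s * (2 / m)\<^sup>2 / (2 * M) = 2 * (real s / (M * m\<^sup>2))"
        by (simp add: power_divide)
      ultimately show ?thesis by simp
    qed
    then have "exp (- (real s * (2 / m)\<^sup>2 / (2 * M))) \<le> exp (2 * ln (p / m))"
      using m p by (simp add: ln_div)
    also have "exp (2 * ln (p / m)) = (p / m)\<^sup>2"
      using m p by (simp add: exp_double)
    finally have "exp (- (real s * (2 / m)\<^sup>2 / (2 * M))) \<le> (p / m)\<^sup>2" .
    moreover have "measure_pmf.prob ?P (bad e) \<le> 2 * exp (- (real s * (2 / m)\<^sup>2 / (2 * M)))"
      unfolding bad_def using ft e m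
      by (intro prob_empirical_median_bad_le fstar_bounds M s0) (auto simp: integral_box_def PiE_iff)
    ultimately show ?thesis by linarith
  qed
  then have "(\<Sum>e\<in>arcs G. measure_pmf.prob ?P (bad e)) \<le> m * (2 * (p / m)\<^sup>2)"
    using sum_bounded_above[of "arcs G" "\<lambda>e. measure_pmf.prob ?P (bad e)" "2 * (p / m)\<^sup>2"] by (simp add: m_def)
  also have "\<dots> = p * (2 * p / m)"
    using m by (simp add: power2_eq_square)
  also have "\<dots> \<le> p * 1"
  proof (intro mult_left_mono)
    \<comment> \<open>This is where \<open>2 \<le> m\<close> or \<open>p \<le> 1 / 2\<close>
      enters.\<close>
    show "2 * p / m \<le> 1" using p m by (auto simp: m_def field_simps)
  qed (use p in simp)
  finally have "measure_pmf.prob ?P (\<Union>e\<in>arcs G. bad e) \<le> p"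
    using measure_pmf.finite_measure_subadditive_finite[of "arcs G" bad ?P] by simp
  moreover have "- ?good \<subseteq> (\<Union>e\<in>arcs G. bad e)"
  proof
    fix cs assume "cs \<in> - ?good"
    then obtain fhat where min: "is_arg_min (empirical_loss G fstar s cs) (\<lambda>f. f \<in> integral_box G c) fhat"
      and gt: "expected_loss G fstar D ft + 2 < expected_loss G fstar D fhat" by auto
    show "cs \<in> (\<Union>e\<in>arcs G. bad e)"
    proof (rule ccontr)
      assume not_bad: "cs \<notin> (\<Union>e\<in>arcs G. bad e)"
      have "edge_loss e (fhat e) \<le> edge_loss e (ft e) + 2 / m" if "e \<in> arcs G" for e
      proof -
        have "cs \<notin> bad e" using not_bad that by blast
        then show ?thesis
          using empirical_minimizer_edge[OF s0 min that] unfolding bad_def mem_Collect_eq by (meson not_less)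
      qed
      then have "expected_loss G fstar D fhat \<le> (\<Sum>e\<in>arcs G. edge_loss e (ft e) + 2 / m)"
        unfolding expected_loss_eq by (rule sum_mono)
      also have "\<dots> = expected_loss G fstar D ft + 2"
        using m ne by (simp add: expected_loss_eq sum.distrib m_def)
      finally show False using gt by simp
    qed
  qed
  then have "measure_pmf.prob ?P (- ?good) \<le> measure_pmf.prob ?P (\<Union>e\<in>arcs G. bad e)"
    by (intro measure_pmf.finite_measure_mono) auto
  moreover have "measure_pmf.prob ?P (- ?good) = 1 - measure_pmf.prob ?P ?good"
    using measure_pmf.prob_compl[of ?good ?P] by (simp add: Compl_eq_Diff_UNIV)
  ultimately show ?thesis by linarith
qed

text \<open>Intended for one edge and \<open>p\<close> above \<open>1 / 2\<close>. With a single
  edge the losses are the edge losses, so the median estimate carries over directly.\<close>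

lemma prob_empirical_minimizer_single_edge_ge:
  assumes e: "arcs G = {e}" and ft: "ft \<in> integral_box G c" and s: "s > 0" "real s \<le> (real (c e))\<^sup>2"
  shows "real s / (64 * (real (c e))\<^sup>2) \<le> measure_pmf.prob (iid_samples s D)
    {cs. \<forall>fhat. is_arg_min (empirical_loss G fstar s cs) (\<lambda>f. f \<in> integral_box G c) fhat \<longrightarrow>
           expected_loss G fstar D fhat \<le> expected_loss G fstar D ft + 2}" (is "_ \<le> measure _ ?good")
proof -
  have "real s / (64 * (real (c e))\<^sup>2) \<le> measure_pmf.prob (iid_samples s D)
     {cs. \<forall>z\<le>c e. (\<forall>y\<le>c e. edge_total s cs e z \<le> edge_total s cs e y) \<longrightarrow>
        edge_loss e z \<le> edge_loss e (ft e) + 2}"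
    using e ft by (intro prob_empirical_median_good_ge fstar_bounds s) (auto simp: integral_box_def PiE_iff)
  also have "\<dots> \<le> measure_pmf.prob (iid_samples s D) ?good"
  proof (intro measure_pmf.finite_measure_mono subsetI CollectI allI impI)
    fix cs fhat
    assume good: "cs \<in> {cs. \<forall>z\<le>c e. (\<forall>y\<le>c e. edge_total s cs e z \<le> edge_total s cs e y) \<longrightarrow>
        edge_loss e z \<le> edge_loss e (ft e) + 2}"
      and min: "is_arg_min (empirical_loss G fstar s cs) (\<lambda>f. f \<in> integral_box G c) fhat"
    show "expected_loss G fstar D fhat \<le> expected_loss G fstar D ft + 2"
      using good empirical_minimizer_edge[OF s(1) min, of e] by (simp add: expected_loss_eq e)
  qed simp
  finally show ?thesis .
qed

end

section \<open>Choice of constants and distinction of regimes\<close>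

theorem theorem3:
  shows "\<exists>C K :: real. C > 0 \<and> K > 0 \<and>
    (\<forall>(G :: ('v, 'e) pre_digraph) (src :: 'v) (snk :: 'v) (c :: 'e \<Rightarrow> nat)
      (fstar :: ('e \<Rightarrow> nat) \<Rightarrow> 'e \<Rightarrow> real) (D :: ('e \<Rightarrow> nat) pmf)
      (s :: nat) (p :: real) (ftilde :: 'e \<Rightarrow> nat).
      fin_digraph G \<longrightarrow>
      src \<in> verts G \<longrightarrow> snk \<in> verts G \<longrightarrow> src \<noteq> snk \<longrightarrow>
      (\<forall>c'\<in>integral_box G c. is_max_flow G src snk c' (fstar c')) \<longrightarrow>
      set_pmf D \<subseteq> integral_box G c \<longrightarrow>
      0 < p \<longrightarrow> p < 1 \<longrightarrow>
      real s \<ge> C * (real (Max ((\<lambda>e. (c e)\<^sup>2) ` arcs G)) * (real (card (arcs G)))\<^sup>2)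
                 * (ln (real (card (arcs G))) + ln (1 / p)) \<longrightarrow>
      is_arg_min (expected_loss G fstar D) (\<lambda>f. f \<in> integral_box G c) ftilde \<longrightarrow>
      measure_pmf.prob (iid_samples s D)
        {cs. \<forall>fhat. is_arg_min (empirical_loss G fstar s cs) (\<lambda>f. f \<in> integral_box G c) fhat \<longrightarrow>
               expected_loss G fstar D fhat \<le> expected_loss G fstar D ftilde + K} \<ge> 1 - p)"
\<comment> \<open>The \<open>64\<close> matches the denominator in the single-edge bound, and the
  \<open>2\<close> is the excess allowed in both regimes.\<close>
proof (rule exI[of _ 64], rule exI[of _ 2], intro conjI allI impI)
  fix G :: "('v, 'e) pre_digraph" and src snk c fstar D s p ftilde
  assume "fin_digraph G"
    and flow: "\<forall>c'\<in>integral_box G c. is_max_flow G src snk c' (fstar c')"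
    and D: "set_pmf D \<subseteq> integral_box G c"
    and p: "0 < p" "p < 1"
    and s: "real s \<ge> 64 * (real (Max ((\<lambda>e. (c e)\<^sup>2) ` arcs G)) * (real (card (arcs G)))\<^sup>2)
                 * (ln (real (card (arcs G))) + ln (1 / p))"
    and ft: "is_arg_min (expected_loss G fstar D) (\<lambda>f. f \<in> integral_box G c) ftilde"
  interpret fin_digraph G by fact
  interpret flow_sampling G c fstar D
  proof
    fix e assume e: "e \<in> arcs G"
    show "\<forall>c'\<in>set_pmf D. 0 \<le> fstar c' e \<and> fstar c' e \<le> real (c e)"
    proof
      fix c' assume "c' \<in> set_pmf D"
      then have box: "c' \<in> integral_box G c" using D by blast
      then have "c' e \<le> c e" using e by (auto simp: integral_box_def PiE_iff)
      then show "0 \<le> fstar c' e \<and> fstar c' e \<le> real (c e)"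
        using is_max_flow_bounds[OF flow[rule_format, OF box] e] by auto
    qed
  qed
  let ?good = "{cs. \<forall>fhat. is_arg_min (empirical_loss G fstar s cs) (\<lambda>f. f \<in> integral_box G c) fhat \<longrightarrow>
               expected_loss G fstar D fhat \<le> expected_loss G fstar D ftilde + 2}"
  let ?m = "card (arcs G)"
  define M where "M = real (Max ((\<lambda>e. (c e)\<^sup>2) ` arcs G))"
  have ft_box: "ftilde \<in> integral_box G c" using ft by (simp add: is_arg_min_def)
  have M_ge: "(real (c e))\<^sup>2 \<le> M" if "e \<in> arcs G" for e
    unfolding M_def using that by (simp flip: of_nat_power)
  have ln_p: "1 - p \<le> ln (1 / p)"
    using ln_le_minus_one[of p] p by (simp add: ln_div)
  show "measure_pmf.prob (iid_samples s D) ?good \<ge> 1 - p"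
  proof (cases "\<exists>e\<in>arcs G. c e > 0")
    \<comment> \<open>Without a positive capacity the box has exactly one element.\<close>
    case False
    have "fhat = ftilde" if "fhat \<in> integral_box G c" for fhat
      using that ft_box False unfolding integral_box_def by (intro PiE_ext) (auto simp: PiE_iff)
    then have "?good = UNIV" by (auto simp: is_arg_min_def)
    then show ?thesis using p by simp
  next
    case True
    then obtain e where e: "e \<in> arcs G" "c e > 0" by blast
    have "0 < (real (c e))\<^sup>2" using e(2) by simp
    then have M: "0 < M" using M_ge[OF e(1)] by linarith
    have m: "1 \<le> ?m" using e(1) by (auto simp: Suc_le_eq card_gt_0_iff)
    have ln_pos: "0 < ln (real ?m) + ln (1 / p)"
      using m p by (intro add_nonneg_pos) auto
    have ne: "arcs G \<noteq> {}" using e(1) by blast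
    have base: "0 < M * (real ?m)\<^sup>2 * (ln (real ?m) + ln (1 / p))"
      using M m ln_pos by (intro mult_pos_pos) auto
    have s64: "64 * (M * (real ?m)\<^sup>2 * (ln (real ?m) + ln (1 / p))) \<le> real s"
      using s by (simp add: M_def mult.assoc)
    then have s1: "M * (real ?m)\<^sup>2 * (ln (real ?m) + ln (1 / p)) \<le> real s"
      using base by simp
    show ?thesis
    proof (cases "2 \<le> ?m \<or> p \<le> 1 / 2")
      case True
      show ?thesis
        by (rule prob_empirical_minimizer_ge[OF ft_box M_ge M p True ne s1])
    next
      case False
      then have "?m = 1" and p_half: "1 / 2 < p" using m by auto
      then have arcs: "arcs G = {e}" using e(1) by (auto simp: card_1_singleton_iff)
      have M_eq: "M = (real (c e))\<^sup>2" by (simp add: M_def arcs)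
      have s_ln: "64 * (M * ln (1 / p)) \<le> real s" using s64 \<open>?m = 1\<close> by simp
      show ?thesis
      \<comment> \<open>A sample this large satisfies the general estimate with \<open>1 / 2\<close>
        in place of \<open>p\<close>, and success probability \<open>1 / 2\<close> exceeds
        \<open>1 - p\<close>. A smaller sample has \<open>s \<le> M\<close>; there the single-edge
        bound is at least \<open>ln (1 / p)\<close>, hence at least \<open>1 - p\<close>.\<close>
      proof (cases "M * ln 2 \<le> real s")
        case True
        have "1 - 1 / 2 \<le> measure_pmf.prob (iid_samples s D) ?good"
          by (rule prob_empirical_minimizer_ge[OF ft_box M_ge M]) (use True arcs in auto)
        then show ?thesis using p_half by simp
      next
        case False
        have "0 < M * ln (1 / p)" using M p by (intro mult_pos_pos) auto
        then have "s > 0" using s_ln by (cases s) auto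
        moreover have "real s \<le> M"
        proof -
          have "M * ln 2 \<le> M * 1" using ln_2_less_1 M by (intro mult_left_mono) auto
          with False show ?thesis by linarith
        qed
        ultimately have "real s / (64 * M) \<le> measure_pmf.prob (iid_samples s D) ?good"
          unfolding M_eq by (intro prob_empirical_minimizer_single_edge_ge arcs ft_box)
        moreover have "ln (1 / p) \<le> real s / (64 * M)"
          using s_ln M by (simp add: field_simps)
        ultimately show ?thesis using ln_p by linarith
      qed
    qed
  qed
qed simp_all

end
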